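(* For a Boolean function $f:\{0,1\}^n\to\{0,1\}$ and $z\in\{0,1\}$, $$\mathsf{MCC}^{z}(f)\leq \mathsf{mbs}^{z}(f)\,\mathsf{ms}^{1-z}(\tilde{f}),$$ where $\tilde f(x):=f(1-x_1,1-x_2,\dots,1-x_n)$.
   Context: For $x\in\{0,1\}^n$ let $\mathrm{supp}(x)=\{i:x_i=1\}$, $|x|=|\mathrm{supp}(x)|$, and let $f_x$ be the restriction of $f$ to $\{y:y_i=1\ \forall i\in\mathrm{supp}(x)\}$, viewed as a function of the remaining $n-|x|$ coordinates. For a Boolean function $h$ and input $w$: $\mathsf{s}(h,w)$ is the number of coordinates $i$ with $h(w^{\oplus i})\ne h(w)$; $\mathsf{bs}(h,w)$ is the maximum number of pairwise disjoint sets $B$ with $h(w^B)\ne h(w)$ ($w^B$ = $w$ with bits in $B$ flipped); $\mathsf{C}(h,w)$ is the minimum size of a set $C$ of coordinates such that every $y$ agreeing with $w$ on $C$ has $h(y)=h(w)$. Define $\mathsf{ms}(f,x)=\mathsf{s}(f_x,0^{n-|x|})$, $\mathsf{mbs}(f,x)=\mathsf{bs}(f_x,0^{n-|x|})$, $\mathsf{MCC}(f,x)=\mathsf{C}(f_x,0^{n-|x|})$, and for a measure $M$ and $b\in\{0,1\}$, $M^b(f)=\max_{x\in f^{-1}(b)}M(f,x)$. *)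

theory Defs
  imports Main "HOL-Library.FuncSet" "HOL-Library.Disjoint_Sets"
begin

text \<open>A Boolean function on a set \<open>I\<close> of coordinates is represented by
  \<open>h :: ('a \<Rightarrow> bool) \<Rightarrow> bool\<close>; only its values on \<open>cube I\<close> are ever used.
  Bits 1 and 0 are \<^const>\<open>True\<close> and \<^const>\<open>False\<close>.
  The coordinate set is a parameter because restricting \<open>f\<close> to the subcube above \<open>x\<close> yields a
  function on the remaining coordinates only.\<close>

definition cube :: "'a set \<Rightarrow> ('a \<Rightarrow> bool) set" where
  "cube I = (I \<rightarrow>\<^sub>E UNIV)"

definition all_zero :: "'a set \<Rightarrow> 'a \<Rightarrow> bool" where
  "all_zero I = (\<lambda>i\<in>I. False)"

definition supp :: "'a set \<Rightarrow> ('a \<Rightarrow> bool) \<Rightarrow> 'a set" where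
  "supp I x = {i \<in> I. x i}"

definition flip :: "'a set \<Rightarrow> 'a set \<Rightarrow> ('a \<Rightarrow> bool) \<Rightarrow> 'a \<Rightarrow> bool" where
  "flip I B w = (\<lambda>i\<in>I. if i \<in> B then \<not> w i else w i)"

definition sensitivity :: "'a set \<Rightarrow> (('a \<Rightarrow> bool) \<Rightarrow> bool) \<Rightarrow> ('a \<Rightarrow> bool) \<Rightarrow> nat" where
  "sensitivity I h w = card {i \<in> I. h (flip I {i} w) \<noteq> h w}"

definition block_sensitivity ::
    "'a set \<Rightarrow> (('a \<Rightarrow> bool) \<Rightarrow> bool) \<Rightarrow> ('a \<Rightarrow> bool) \<Rightarrow> nat" where
  "block_sensitivity I h w =
     Max (card ` {\<B>. \<B> \<subseteq> Pow I \<and> disjoint \<B> \<and> (\<forall>B\<in>\<B>. h (flip I B w) \<noteq> h w)})"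

definition certificate_complexity ::
    "'a set \<Rightarrow> (('a \<Rightarrow> bool) \<Rightarrow> bool) \<Rightarrow> ('a \<Rightarrow> bool) \<Rightarrow> nat" where
  "certificate_complexity I h w =
     Min (card ` {C. C \<subseteq> I \<and> (\<forall>y\<in>cube I. (\<forall>i\<in>C. y i = w i) \<longrightarrow> h y = h w)})"

text \<open>The function \<open>f\<^sub>x\<close>, on the coordinates \<open>I - supp I x\<close>.\<close>

definition up_restrict ::
    "'a set \<Rightarrow> (('a \<Rightarrow> bool) \<Rightarrow> bool) \<Rightarrow> ('a \<Rightarrow> bool) \<Rightarrow> ('a \<Rightarrow> bool) \<Rightarrow> bool" where
  "up_restrict I f x = (\<lambda>w. f (\<lambda>i\<in>I. if i \<in> supp I x then True else w i))"

definition ms :: "'a set \<Rightarrow> (('a \<Rightarrow> bool) \<Rightarrow> bool) \<Rightarrow> ('a \<Rightarrow> bool) \<Rightarrow> nat" where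
  "ms I f x = sensitivity (I - supp I x) (up_restrict I f x) (all_zero (I - supp I x))"

definition mbs :: "'a set \<Rightarrow> (('a \<Rightarrow> bool) \<Rightarrow> bool) \<Rightarrow> ('a \<Rightarrow> bool) \<Rightarrow> nat" where
  "mbs I f x = block_sensitivity (I - supp I x) (up_restrict I f x) (all_zero (I - supp I x))"

definition MCC :: "'a set \<Rightarrow> (('a \<Rightarrow> bool) \<Rightarrow> bool) \<Rightarrow> ('a \<Rightarrow> bool) \<Rightarrow> nat" where
  "MCC I f x =
     certificate_complexity (I - supp I x) (up_restrict I f x) (all_zero (I - supp I x))"

text \<open>The maximum \<open>M\<^sup>b(f)\<close> of \<open>M(f,x)\<close> over \<open>x \<in> f\<^sup>-\<^sup>1(b)\<close>. On \<^typ>\<open>nat\<close>, the supremum is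
  the maximum for nonempty finite sets, and it is 0 for the empty set, which is the convention
  taken here when \<open>f\<close> does not attain \<open>b\<close>.\<close>

definition max_at ::
    "('a set \<Rightarrow> (('a \<Rightarrow> bool) \<Rightarrow> bool) \<Rightarrow> ('a \<Rightarrow> bool) \<Rightarrow> nat) \<Rightarrow>
      'a set \<Rightarrow> bool \<Rightarrow> (('a \<Rightarrow> bool) \<Rightarrow> bool) \<Rightarrow> nat" where
  "max_at M I b f = (SUP x\<in>{x \<in> cube I. f x = b}. M I f x)"

definition negate_inputs :: "'a set \<Rightarrow> (('a \<Rightarrow> bool) \<Rightarrow> bool) \<Rightarrow> ('a \<Rightarrow> bool) \<Rightarrow> bool" where
  "negate_inputs I f = (\<lambda>x. f (\<lambda>i\<in>I. \<not> x i))"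

end

theory Submission
  imports Defs
begin

text \<open>Fix \<open>x\<close> with \<open>f x = z\<close> and a maximal disjoint family of inclusion-minimal sensitive blocks of
  \<open>f\<^sub>x\<close> at the zero input. By maximality the union of the family meets every sensitive block, so it
  is a certificate. If \<open>B\<close> is one of the blocks, flipping \<open>B\<close> in \<open>x\<close> gives a point \<open>y\<close> with
  \<open>f y \<noteq> z\<close>, and by minimality turning any single coordinate of \<open>B\<close> back to 0 restores the value
  \<open>z\<close>. Negating all inputs makes these downward flips upward ones, so \<open>card B\<close> is at most the
  monotone sensitivity of the negated function at the complement of \<open>y\<close>.\<close>

text \<open>Minimality is tested only against deleting one coordinate, a weaker condition than
  inclusion-minimality. This is the form from which sensitivity at the flipped point is read
  off.\<close>

definition minimal_block ::
    "'a set \<Rightarrow> (('a \<Rightarrow> bool) \<Rightarrow> bool) \<Rightarrow> ('a \<Rightarrow> bool) \<Rightarrow> 'a set \<Rightarrow> bool" where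
  "minimal_block I h w B \<longleftrightarrow>
     B \<subseteq> I \<and> h (flip I B w) \<noteq> h w \<and> (\<forall>i\<in>B. h (flip I (B - {i}) w) = h w)"

lemma flip_empty: "w \<in> cube I \<Longrightarrow> flip I {} w = w"
  by (auto simp: flip_def cube_def PiE_def extensional_def fun_eq_iff)

lemma flip_difference:
  assumes "w \<in> cube I" and "y \<in> cube I"
  shows "flip I {i \<in> I. y i \<noteq> w i} w = y"
  using assms by (auto simp: flip_def cube_def PiE_def extensional_def fun_eq_iff)

lemma sensitive_block_contains_minimal:
  assumes "finite I" and "B \<subseteq> I" and "h (flip I B w) \<noteq> h w"
  obtains M where "M \<subseteq> B" and "minimal_block I h w M"
proof -
  let ?S = "{A. A \<subseteq> B \<and> h (flip I A w) \<noteq> h w}"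
  have "finite ?S" "B \<in> ?S"
    using assms finite_subset[of B I] by auto
  from finite_has_minimal2[OF this]
  obtain M where M: "M \<in> ?S" "\<forall>A\<in>?S. A \<subseteq> M \<longrightarrow> M = A"
    by (elim bexE conjE)
  have "h (flip I (M - {i}) w) = h w" if "i \<in> M" for i
    using M(1) M(2) that by blast
  then show thesis
    using M(1) assms(2) that[of M] by (auto simp: minimal_block_def)
qed

lemma block_sensitivity_ge_card:
  assumes "finite I" and "\<B> \<subseteq> Pow I" and "disjoint \<B>"
    and "\<And>B. B \<in> \<B> \<Longrightarrow> h (flip I B w) \<noteq> h w"
  shows "card \<B> \<le> block_sensitivity I h w"
  unfolding block_sensitivity_def
proof (rule Max_ge)
  have "finite (Pow (Pow I))"
    using assms(1) by simp
  then show "finite (card ` {\<B>. \<B> \<subseteq> Pow I \<and> disjoint \<B> \<and> (\<forall>B\<in>\<B>. h (flip I B w) \<noteq> h w)})"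
    by (rule finite_imageI[OF finite_subset[rotated]]) auto
qed (use assms in auto)

lemma certificate_complexity_le_card:
  assumes "finite I" and "C \<subseteq> I"
    and "\<And>y. y \<in> cube I \<Longrightarrow> (\<And>i. i \<in> C \<Longrightarrow> y i = w i) \<Longrightarrow> h y = h w"
  shows "certificate_complexity I h w \<le> card C"
  unfolding certificate_complexity_def
proof (rule Min_le)
  have "finite (Pow I)"
    using assms(1) by simp
  then show "finite (card ` {C. C \<subseteq> I \<and> (\<forall>y\<in>cube I. (\<forall>i\<in>C. y i = w i) \<longrightarrow> h y = h w)})"
    by (rule finite_imageI[OF finite_subset[rotated]]) auto
qed (use assms in auto)

text \<open>A version at one input of the classical bound of certificate complexity by block
  sensitivity times sensitivity. The bound \<open>k\<close> is left abstract because block sizes are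
  later controlled by sensitivity of another function at other points.\<close>

lemma certificate_complexity_le_block_sensitivity_mult:
  assumes fin: "finite I" and w: "w \<in> cube I"
    and small: "\<And>B. minimal_block I h w B \<Longrightarrow> card B \<le> k"
  shows "certificate_complexity I h w \<le> block_sensitivity I h w * k"
proof -
  \<comment> \<open>Maximality among families of minimal blocks suffices, since every sensitive
    block contains a minimal one.\<close>
  let ?F = "{\<B>. disjoint \<B> \<and> (\<forall>B\<in>\<B>. minimal_block I h w B)}"
  have "?F \<subseteq> Pow (Pow I)"
    by (auto simp: minimal_block_def)
  then have "finite ?F"
    using fin by (auto intro: finite_subset)
  moreover have "{} \<in> ?F"
    by (simp add: disjoint_def)
  ultimately obtain \<B> where \<B>: "\<B> \<in> ?F" "\<forall>\<A>\<in>?F. \<B> \<subseteq> \<A> \<longrightarrow> \<B> = \<A>"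
    by (elim finite_has_maximal2[THEN bexE] conjE)
  have sub: "\<B> \<subseteq> Pow I"
    using \<B>(1) by (auto simp: minimal_block_def)
  have "certificate_complexity I h w \<le> card (\<Union>\<B>)"
  proof (rule certificate_complexity_le_card)
    fix y assume y: "y \<in> cube I" and agree: "\<And>i. i \<in> \<Union>\<B> \<Longrightarrow> y i = w i"
    show "h y = h w"
    proof (rule ccontr)
      assume "h y \<noteq> h w"
      then have "h (flip I {i \<in> I. y i \<noteq> w i} w) \<noteq> h w"
        using flip_difference[OF w y] by simp
      then obtain M where M: "M \<subseteq> {i \<in> I. y i \<noteq> w i}" "minimal_block I h w M"
        using sensitive_block_contains_minimal[OF fin, of "{i \<in> I. y i \<noteq> w i}" h w] by blast
      have "M \<inter> \<Union>\<B> = {}"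
        using M(1) agree by blast
      then have "insert M \<B> \<in> ?F"
        using M(2) \<B>(1) by (auto simp: disjoint_def)
      then have "\<B> = insert M \<B>"
        by (rule bspec[OF \<B>(2), THEN mp, OF _ subset_insertI])
      then have "M \<in> \<B>"
        by blast
      \<comment> \<open>A member of the family that avoids its union is empty, and flipping nothing
        cannot change the value.\<close>
      with \<open>M \<inter> \<Union>\<B> = {}\<close> have "M = {}"
        by blast
      then show False
        using M(2) flip_empty[OF w] by (simp add: minimal_block_def)
    qed
  qed (use fin sub in auto)
  also have "\<dots> \<le> (\<Sum>B\<in>\<B>. card B)"
    by (rule card_Union_le_sum_card)
  also have "\<dots> \<le> card \<B> * k"
    using sum_bounded_above[of \<B> card k] small \<B>(1) by auto
  also have "\<dots> \<le> block_sensitivity I h w * k"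
    using block_sensitivity_ge_card[OF fin sub] \<B>(1) by (simp add: minimal_block_def)
  finally show ?thesis .
qed

text \<open>Off its support \<open>x\<close> is 0, so flipping the zero input of the restricted
  function amounts to flipping \<open>x\<close> itself. This transfers sensitivity of the
  restriction to \<open>f\<close>.\<close>

lemma up_restrict_flip_all_zero:
  assumes "x \<in> cube I" and "B \<subseteq> I - supp I x"
  shows "up_restrict I f x (flip (I - supp I x) B (all_zero (I - supp I x))) = f (flip I B x)"
proof -
  have "(\<lambda>i\<in>I. if i \<in> supp I x then True
           else flip (I - supp I x) B (all_zero (I - supp I x)) i) = flip I B x"
    using assms by (auto simp: flip_def all_zero_def supp_def fun_eq_iff)
  then show ?thesis
    by (simp add: up_restrict_def)
qed

lemma all_zero_in_cube: "all_zero I \<in> cube I"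
  by (simp add: all_zero_def cube_def)

lemma up_restrict_all_zero:
  assumes "x \<in> cube I"
  shows "up_restrict I f x (all_zero (I - supp I x)) = f x"
  using up_restrict_flip_all_zero[OF assms, of "{}" f]
  by (simp add: flip_empty all_zero_in_cube assms)

text \<open>The coordinates free above the complement of \<open>y\<close> are the 1s of
  \<open>y\<close>, and raising one of them there lowers it in \<open>y\<close>.\<close>

lemma ms_negate_inputs:
  assumes "y \<in> cube I"
  shows "ms I (negate_inputs I f) (\<lambda>i\<in>I. \<not> y i) = card {i \<in> I. y i \<and> f (flip I {i} y) \<noteq> f y}"
proof -
  let ?c = "\<lambda>i\<in>I. \<not> y i"
  have c: "?c \<in> cube I"
    by (simp add: cube_def)
  have supp: "I - supp I ?c = {i \<in> I. y i}"
    by (auto simp: supp_def)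
  have "(\<lambda>i\<in>I. \<not> ?c i) = y"
    using assms by (auto simp: cube_def PiE_def extensional_def fun_eq_iff)
  moreover have "(\<lambda>j\<in>I. \<not> flip I {i} ?c j) = flip I {i} y" for i
    by (auto simp: flip_def fun_eq_iff)
  ultimately have "{i \<in> I - supp I ?c.
      up_restrict I (negate_inputs I f) ?c (flip (I - supp I ?c) {i} (all_zero (I - supp I ?c)))
        \<noteq> up_restrict I (negate_inputs I f) ?c (all_zero (I - supp I ?c))}
    = {i \<in> I - supp I ?c. f (flip I {i} y) \<noteq> f y}"
    using up_restrict_flip_all_zero[OF c] up_restrict_all_zero[OF c]
    by (auto simp: negate_inputs_def)
  then show ?thesis
    unfolding ms_def sensitivity_def supp by simp
qed

lemma max_at_upper:
  assumes "finite I" and "x \<in> cube I" and "f x = b"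
  shows "M I f x \<le> max_at M I b f"
proof -
  have "finite (cube I)"
    using assms(1) by (simp add: cube_def finite_PiE)
  then show ?thesis
    unfolding max_at_def using assms
    by (intro cSUP_upper bdd_above_finite finite_imageI) auto
qed

lemma max_at_least:
  assumes "\<And>x. x \<in> cube I \<Longrightarrow> f x = b \<Longrightarrow> M I f x \<le> k"
  shows "max_at M I b f \<le> k"
proof (cases "{x \<in> cube I. f x = b} = {}")
  \<comment> \<open>If \<open>f\<close> never takes the value \<open>b\<close>, the supremum is that
    of the empty set, which is 0 on the naturals.\<close>
  case True
  then show ?thesis
    unfolding max_at_def True by simp
next
  case False
  then show ?thesis
    unfolding max_at_def using assms by (intro cSUP_least) auto
qed

lemma card_minimal_block_le:
  assumes fin: "finite I" and x: "x \<in> cube I"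
    and B: "minimal_block (I - supp I x) (up_restrict I f x) (all_zero (I - supp I x)) B"
  shows "card B \<le> max_at ms I (\<not> f x) (negate_inputs I f)"
proof -
  let ?y = "flip I B x"
  have sub: "B \<subseteq> I - supp I x"
    using B by (simp add: minimal_block_def)
  have fy: "f ?y \<noteq> f x"
    using B up_restrict_flip_all_zero[OF x sub, of f] up_restrict_all_zero[OF x, of f]
    by (simp add: minimal_block_def)
  have y: "?y \<in> cube I"
    by (simp add: flip_def cube_def)
  \<comment> \<open>Since \<open>x\<close> is 0 on \<open>B\<close>, every coordinate of
    \<open>B\<close> is 1 in \<open>?y\<close>. Flipping \<open>i\<close> back undoes its part of
    the block, and minimality returns the value \<open>f x\<close>.\<close>
  have "i \<in> I \<and> ?y i \<and> f (flip I {i} ?y) \<noteq> f ?y" if "i \<in> B" for i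
  proof -
    have "flip I {i} ?y = flip I (B - {i}) x"
      using that by (auto simp: flip_def fun_eq_iff)
    moreover have "f (flip I (B - {i}) x) = f x"
      using B that sub up_restrict_flip_all_zero[OF x, of "B - {i}" f] up_restrict_all_zero[OF x, of f]
      by (auto simp: minimal_block_def)
    ultimately show ?thesis
      using that sub fy by (auto simp: flip_def supp_def)
  qed
  then have "card B \<le> card {i \<in> I. ?y i \<and> f (flip I {i} ?y) \<noteq> f ?y}"
    using fin by (intro card_mono) auto
  also have "\<dots> = ms I (negate_inputs I f) (\<lambda>i\<in>I. \<not> ?y i)"
    by (rule ms_negate_inputs[OF y, symmetric])
  also have "\<dots> \<le> max_at ms I (\<not> f x) (negate_inputs I f)"
  proof (rule max_at_upper[OF fin])
    have "(\<lambda>i\<in>I. \<not> (\<lambda>i\<in>I. \<not> ?y i) i) = ?y"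
      by (auto simp: flip_def fun_eq_iff)
    then show "negate_inputs I f (\<lambda>i\<in>I. \<not> ?y i) = (\<not> f x)"
      using fy by (simp add: negate_inputs_def)
  qed (auto simp: cube_def)
  finally show ?thesis .
qed

theorem theorem4:
  fixes n :: nat and f :: "(nat \<Rightarrow> bool) \<Rightarrow> bool" and z :: bool
  shows "max_at MCC {1..n} z f
       \<le> max_at mbs {1..n} z f * max_at ms {1..n} (\<not> z) (negate_inputs {1..n} f)"
proof (rule max_at_least)
  let ?I = "{1..n}"
  fix x assume x: "x \<in> cube ?I" and fx: "f x = z"
  \<comment> \<open>The second factor is already a maximum here because the flipped point depends on
    the block; only the first factor is still tied to \<open>x\<close>.\<close>
  have "MCC ?I f x \<le> mbs ?I f x * max_at ms ?I (\<not> z) (negate_inputs ?I f)"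
    unfolding MCC_def mbs_def
    using card_minimal_block_le[OF _ x, of f] fx
    by (intro certificate_complexity_le_block_sensitivity_mult all_zero_in_cube) auto
  also have "\<dots> \<le> max_at mbs ?I z f * max_at ms ?I (\<not> z) (negate_inputs ?I f)"
    using max_at_upper[of ?I x f z mbs] x fx by simp
  finally show "MCC ?I f x
      \<le> max_at mbs ?I z f * max_at ms ?I (\<not> z) (negate_inputs ?I f)" .
qed

end
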